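(* For every integer $n\ge 1$, the set $H_n\subseteq\mathbb{R}^{2^n-1}$ is a cone of dimension $2^n-1$ (i.e. it is full-dimensional).
   Context: For a positive integer $k$ let $[k]=\{1,\dots,k\}$. $K_N$ is the undirected complete graph on vertex set $[N]$, with edge set $E_N=\{(i,j):1\le i<j\le N\}$. A weight map is a function $w:E_N\to\mathbb{R}_{\ge 0}$. For $W\subseteq[N]$, the cut $C(W)$ is the set of edges with exactly one endpoint in $W$, and $\|C(W)\|$ is the sum of the weights of its edges. For integers $1\le n<N$, the vertices in $[n]$ of $K_N$ are called terminals, vertex $N$ is the sink, and the remaining vertices are bulk vertices. Given $w$ on $K_N$, for each $\varnothing\ne I\subseteq[n]$ set $$S_I=\min\{\|C(W)\| : W\subseteq[N-1],\ W\cap[n]=I\}.$$ The resulting vector $S=(S_I)_{\varnothing\ne I\subseteq[n]}\in\mathbb{R}^{2^n-1}$ is said to be realized by $w$ in $K_N$, and $(S,w)$ is called a valid pair. The holographic entropy cone is $H_n=\{S\in\mathbb{R}^{2^n-1} : (S,w)\text{ is a valid pair for some } N>n \text{ and some weight map } w \text{ on } K_N\}$. A cone is a set closed under multiplication by positive scalars; its dimension is the dimension of its linear span. *)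

theory Defs
  imports Complex_Main "HOL-Library.Function_Algebras"
begin

definition edges :: "nat \<Rightarrow> (nat \<times> nat) set" where
  "edges N = {(i, j). 1 \<le> i \<and> i < j \<and> j \<le> N}"

(* Only the values of w on edges N matter; all other values are unconstrained and never used. *)
definition weight_map :: "nat \<Rightarrow> (nat \<times> nat \<Rightarrow> real) \<Rightarrow> bool" where
  "weight_map N w \<longleftrightarrow> (\<forall>e \<in> edges N. 0 \<le> w e)"

definition cut :: "nat \<Rightarrow> nat set \<Rightarrow> (nat \<times> nat) set" where
  "cut N W = {(i, j) \<in> edges N. (i \<in> W) \<noteq> (j \<in> W)}"

definition cut_weight :: "nat \<Rightarrow> (nat \<times> nat \<Rightarrow> real) \<Rightarrow> nat set \<Rightarrow> real" where
  "cut_weight N w W = (\<Sum>e \<in> cut N W. w e)"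

definition min_cut :: "nat \<Rightarrow> nat \<Rightarrow> (nat \<times> nat \<Rightarrow> real) \<Rightarrow> nat set \<Rightarrow> real" where
  "min_cut n N w I = Min {cut_weight N w W | W. W \<subseteq> {1..N - 1} \<and> W \<inter> {1..n} = I}"

definition index_sets :: "nat \<Rightarrow> nat set set" where
  "index_sets n = {I. I \<noteq> {} \<and> I \<subseteq> {1..n}}"

(* The space of real vectors with one coordinate for each of the 2^n - 1 index sets, encoded as
   the functions on all sets of naturals that vanish off the index sets; in this way it is a
   linear subspace of the function space. *)
definition entropy_space :: "nat \<Rightarrow> (nat set \<Rightarrow> real) set" where
  "entropy_space n = {S. \<forall>I. I \<notin> index_sets n \<longrightarrow> S I = 0}"

definition valid_pair ::
  "nat \<Rightarrow> nat \<Rightarrow> (nat set \<Rightarrow> real) \<Rightarrow> (nat \<times> nat \<Rightarrow> real) \<Rightarrow> bool" where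
  "valid_pair n N S w \<longleftrightarrow>
     weight_map N w \<and> S \<in> entropy_space n \<and> (\<forall>I \<in> index_sets n. S I = min_cut n N w I)"

definition holographic_entropy_cone :: "nat \<Rightarrow> (nat set \<Rightarrow> real) set" where
  "holographic_entropy_cone n = {S \<in> entropy_space n. \<exists>N w. n < N \<and> valid_pair n N S w}"

definition scale_vec :: "real \<Rightarrow> (nat set \<Rightarrow> real) \<Rightarrow> nat set \<Rightarrow> real" where
  "scale_vec c S = (\<lambda>I. c * S I)"

interpretation entropy_vec: vector_space scale_vec
  by unfold_locales (auto simp: scale_vec_def fun_eq_iff algebra_simps)

(* Closure under positive scalars only, unlike the library's cone, which also requires
   closure under multiplication by 0. *)
definition is_cone :: "(nat set \<Rightarrow> real) set \<Rightarrow> bool" where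
  "is_cone K \<longleftrightarrow> (\<forall>S \<in> K. \<forall>c > 0. scale_vec c S \<in> K)"

end

theory Submission imports Defs begin

text \<open>
  For a nonempty set of terminals \<open>T\<close>, join one bulk vertex to every vertex of \<open>T\<close> by an edge of
  weight \<open>1\<close> and to the sink by an edge of weight \<open>a\<close>. This star realizes the vector
  \<open>I \<mapsto> min \<bar>I \<inter> T\<bar> (\<bar>T - I\<bar> + a)\<close>. For \<open>a = \<bar>T\<bar>\<close> this is \<open>\<bar>I \<inter> T\<bar>\<close>, and for \<open>a = \<bar>T\<bar> - 1\<close> it drops
  by one exactly when \<open>T \<subseteq> I\<close>. The difference of the two vectors is the indicator of \<open>T \<subseteq> I\<close>;
  these indicators form a unitriangular system with respect to inclusion, so they span the
  whole space.
\<close>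

lemma finite_edges: "finite (edges N)"
  by (rule finite_subset[of _ "{1..N} \<times> {1..N}"]) (auto simp: edges_def)

lemma finite_index_sets: "finite (index_sets n)"
  by (rule finite_subset[of _ "Pow {1..n}"]) (auto simp: index_sets_def)

lemma card_index_sets: "card (index_sets n) = 2 ^ n - 1"
proof -
  have "index_sets n = Pow {1..n} - {{}}"
    by (auto simp: index_sets_def)
  then show ?thesis
    by (simp add: card_Pow)
qed

lemma finite_cut_weights:
  "finite {cut_weight N w W | W. W \<subseteq> {1..N - 1} \<and> W \<inter> {1..n} = I}"
proof -
  have "{cut_weight N w W | W. W \<subseteq> {1..N - 1} \<and> W \<inter> {1..n} = I}
      \<subseteq> cut_weight N w ` Pow {1..N - 1}"
    by auto
  then show ?thesis
    by (rule finite_subset) simp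
qed

text \<open>Each cut weight is linear in the weights, and multiplication by a positive constant is
  monotone, so it commutes with the minimum.\<close>

lemma min_cut_scale:
  assumes "n < N" "I \<in> index_sets n" "0 < c"
  shows "min_cut n N (\<lambda>e. c * w e) I = c * min_cut n N w I"
proof -
  let ?A = "{cut_weight N w W | W. W \<subseteq> {1..N - 1} \<and> W \<inter> {1..n} = I}"
  \<comment> \<open>Since \<open>n < N\<close>, the set \<open>I\<close> is itself an admissible
    \<open>W\<close>, so the minimum ranges over a nonempty set.\<close>
  have "I \<subseteq> {1..n}" "{1..n} \<subseteq> {1..N - 1}"
    using assms by (auto simp: index_sets_def)
  then have "I \<subseteq> {1..N - 1} \<and> I \<inter> {1..n} = I"
    by blast
  then have ne: "?A \<noteq> {}"
    by blast
  have "mono ((*) c)"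
    using assms(3) by (auto intro!: monoI)
  then have "c * Min ?A = Min ((*) c ` ?A)"
    using finite_cut_weights ne by (rule mono_Min_commute)
  moreover have "(*) c ` ?A
      = {cut_weight N (\<lambda>e. c * w e) W | W. W \<subseteq> {1..N - 1} \<and> W \<inter> {1..n} = I}"
    by (simp add: setcompr_eq_image image_image cut_weight_def sum_distrib_left)
  ultimately show ?thesis
    by (simp add: min_cut_def)
qed

lemma is_cone_holographic_entropy_cone: "is_cone (holographic_entropy_cone n)"
  unfolding is_cone_def
proof (intro ballI allI impI)
  fix S and c :: real
  assume "S \<in> holographic_entropy_cone n" and c: "0 < c"
  then obtain N w where "n < N" "valid_pair n N S w"
    by (auto simp: holographic_entropy_cone_def)
  then have "valid_pair n N (scale_vec c S) (\<lambda>e. c * w e)"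
    using c by (auto simp: valid_pair_def weight_map_def entropy_space_def scale_vec_def
        min_cut_scale)
  then show "scale_vec c S \<in> holographic_entropy_cone n"
    using \<open>n < N\<close> by (auto simp: holographic_entropy_cone_def valid_pair_def)
qed

text \<open>Meant for the complete graph on \<open>n + 2\<close> vertices: \<open>n + 1\<close> is
  the only bulk vertex, the centre of the star, and \<open>n + 2\<close> is the sink.\<close>

definition star_weight :: "nat \<Rightarrow> nat set \<Rightarrow> real \<Rightarrow> nat \<times> nat \<Rightarrow> real" where
  "star_weight n T a = (\<lambda>(i, j).
     if j = n + 1 \<and> i \<in> T then 1 else if i = n + 1 \<and> j = n + 2 then a else 0)"

definition star_vec :: "nat \<Rightarrow> nat set \<Rightarrow> real \<Rightarrow> nat set \<Rightarrow> real" where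
  "star_vec n T a = (\<lambda>I.
     if I \<in> index_sets n then min (real (card (I \<inter> T))) (real (card (T - I)) + a) else 0)"

text \<open>Only star edges carry weight. A terminal edge is cut when its terminal and the centre
  lie on different sides; the sink is never in \<open>W\<close>, so the sink edge is cut exactly
  when the centre is in \<open>W\<close>.\<close>

lemma cut_weight_star:
  assumes T: "T \<subseteq> {1..n}" and W: "W \<subseteq> {1..n + 1}"
  shows "cut_weight (n + 2) (star_weight n T a) W =
    (if n + 1 \<in> W then real (card (T - W)) + a else real (card (T \<inter> W)))"
proof -
  let ?c = "n + 1"
  \<comment> \<open>\<open>?P\<close> and \<open>?Q\<close> collect the cut star edges at terminals
    and at the sink; their second endpoints differ, so they are disjoint.\<close>
  let ?P = "(\<lambda>t. (t, ?c)) ` {t \<in> T. (t \<in> W) \<noteq> (?c \<in> W)}"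
  let ?Q = "if ?c \<in> W then {(?c, n + 2)} else {}"
  have fT: "finite T"
    using T finite_subset by blast
  have sub: "?P \<union> ?Q \<subseteq> cut (n + 2) W"
    using T W by (auto simp: cut_def edges_def)
  have zero: "star_weight n T a e = 0" if "e \<in> cut (n + 2) W - (?P \<union> ?Q)" for e
    using that W by (cases e) (auto simp: cut_def edges_def star_weight_def split: if_splits)
  have fin: "finite (cut (n + 2) W)"
    by (rule finite_subset[OF _ finite_edges]) (auto simp: cut_def)
  have "cut_weight (n + 2) (star_weight n T a) W = sum (star_weight n T a) (?P \<union> ?Q)"
    unfolding cut_weight_def by (rule sum.mono_neutral_right) (use fin sub zero in auto)
  also have "\<dots> = sum (star_weight n T a) ?P + sum (star_weight n T a) ?Q"
    by (rule sum.union_disjoint) (use fT in auto)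
  also have "sum (star_weight n T a) ?P = real (card {t \<in> T. (t \<in> W) \<noteq> (?c \<in> W)})"
    by (subst sum.reindex) (auto simp: inj_on_def star_weight_def)
  also have "sum (star_weight n T a) ?Q = (if ?c \<in> W then a else 0)"
    using T by (auto simp: star_weight_def)
  finally show ?thesis
    by (auto simp: Int_def set_diff_eq)
qed

text \<open>The only freedom in \<open>W\<close> is whether the centre joins \<open>I\<close>, so
  the minimum is over two cuts.\<close>

lemma min_cut_star:
  assumes T: "T \<subseteq> {1..n}" and I: "I \<in> index_sets n"
  shows "min_cut n (n + 2) (star_weight n T a) I
    = min (real (card (I \<inter> T))) (real (card (T - I)) + a)"
proof -
  let ?cw = "cut_weight (n + 2) (star_weight n T a)"
  have I': "I \<subseteq> {1..n}"
    using I by (simp add: index_sets_def)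
  have "{1..n + 1} = insert (n + 1) {1..n}"
    by auto
  then have "{W. W \<subseteq> {1..n + 1} \<and> W \<inter> {1..n} = I} = {I, insert (n + 1) I}"
    using I' by auto
  moreover have "{?cw W | W. W \<subseteq> {1..n + 2 - 1} \<and> W \<inter> {1..n} = I}
      = ?cw ` {W. W \<subseteq> {1..n + 1} \<and> W \<inter> {1..n} = I}"
    by (simp add: setcompr_eq_image)
  ultimately have "{?cw W | W. W \<subseteq> {1..n + 2 - 1} \<and> W \<inter> {1..n} = I}
      = ?cw ` {I, insert (n + 1) I}"
    by simp
  moreover have "?cw I = real (card (I \<inter> T))"
    using I' by (subst cut_weight_star[OF T]) (auto simp: Int_commute)
  moreover have "?cw (insert (n + 1) I) = real (card (T - I)) + a"
  proof -
    have "T - insert (n + 1) I = T - I"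
      using T by auto
    then show ?thesis
      using I' by (subst cut_weight_star[OF T]) auto
  qed
  ultimately show ?thesis
    by (simp add: min_cut_def)
qed

lemma star_vec_in_holographic_entropy_cone:
  assumes "T \<subseteq> {1..n}" "0 \<le> a"
  shows "star_vec n T a \<in> holographic_entropy_cone n"
proof -
  have "valid_pair n (n + 2) (star_vec n T a) (star_weight n T a)"
    unfolding valid_pair_def
  proof (intro conjI)
    show "weight_map (n + 2) (star_weight n T a)"
      using assms(2) by (auto simp: weight_map_def star_weight_def)
  qed (use min_cut_star[OF assms(1)] in \<open>simp_all add: entropy_space_def star_vec_def\<close>)
  then show ?thesis
    by (auto simp: holographic_entropy_cone_def valid_pair_def intro!: exI[of _ "n + 2"])
qed

definition unit_vec :: "nat set \<Rightarrow> nat set \<Rightarrow> real" where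
  "unit_vec J = (\<lambda>I. if I = J then 1 else 0)"

lemma sum_fun_apply: "(\<Sum>a\<in>A. f a) x = (\<Sum>a\<in>A. f a x)"
  for f :: "'a \<Rightarrow> 'b \<Rightarrow> 'c::comm_monoid_add"
  by (induction A rule: infinite_finite_induct) auto

text \<open>If \<open>T \<subseteq> I\<close>, the two minima are \<open>card T\<close> and
  \<open>card T - 1\<close>. Otherwise \<open>card (T - I) \<ge> 1\<close>, so
  \<open>card (I \<inter> T) \<le> card T - 1\<close> and both minima equal
  \<open>card (I \<inter> T)\<close>.\<close>

lemma star_vec_diff:
  assumes T: "T \<in> index_sets n"
  shows "star_vec n T (card T) - star_vec n T (real (card T) - 1)
    = (\<Sum>J \<in> {J \<in> index_sets n. T \<subseteq> J}. unit_vec J)"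
proof
  fix I
  have fT: "finite T"
    using T finite_subset by (auto simp: index_sets_def)
  have split: "card (I \<inter> T) + card (T - I) = card T"
    using card_Diff_subset_Int[of T I] card_mono[OF fT, of "I \<inter> T"] fT
    by (simp add: Int_commute)
  have zero: "card (T - I) = 0 \<longleftrightarrow> T \<subseteq> I"
    using fT by auto
  have "(\<Sum>J \<in> {J \<in> index_sets n. T \<subseteq> J}. unit_vec J) I
      = (if I \<in> index_sets n \<and> T \<subseteq> I then 1 else 0)"
    by (simp add: sum_fun_apply unit_vec_def finite_index_sets)
  then show "(star_vec n T (card T) - star_vec n T (real (card T) - 1)) I
      = (\<Sum>J \<in> {J \<in> index_sets n. T \<subseteq> J}. unit_vec J) I"
    using split zero by (cases "card (T - I)") (auto simp: star_vec_def min_def)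
qed

text \<open>Back substitution in the unitriangular system, from large sets down: the unit vectors of
  all proper supersets of \<open>T\<close> are subtracted from the indicator of
  \<open>T \<subseteq> I\<close>.\<close>

lemma unit_vec_in_span_cone:
  assumes "T \<in> index_sets n"
  shows "unit_vec T \<in> entropy_vec.span (holographic_entropy_cone n)"
  using assms
proof (induction "n - card T" arbitrary: T rule: less_induct)
  case less
  let ?V = "entropy_vec.span (holographic_entropy_cone n)"
  let ?U = "{J \<in> index_sets n. T \<subseteq> J}"
  have T: "T \<subseteq> {1..n}" "T \<noteq> {}"
    using less.prems by (auto simp: index_sets_def)
  \<comment> \<open>This keeps the sink weight \<open>card T - 1\<close> nonnegative, so that both
    stars are realizable.\<close>
  then have "1 \<le> card T"
    by (metis One_nat_def Suc_leI card_gt_0_iff finite_atLeastAtMost finite_subset)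
  then have "star_vec n T (card T) - star_vec n T (real (card T) - 1) \<in> ?V"
    by (intro entropy_vec.span_diff entropy_vec.span_base star_vec_in_holographic_entropy_cone T)
      auto
  then have "(\<Sum>J \<in> ?U. unit_vec J) \<in> ?V"
    by (simp only: star_vec_diff[OF less.prems])
  moreover have "(\<Sum>J \<in> ?U - {T}. unit_vec J) \<in> ?V"
  proof (rule entropy_vec.span_sum)
    fix J assume J: "J \<in> ?U - {T}"
    then have sub: "J \<subseteq> {1..n}"
      by (auto simp: index_sets_def)
    then have "card T < card J"
      using J finite_subset by (intro psubset_card_mono) blast+
    \<comment> \<open>Together with \<open>card T < card J\<close> this gives
      \<open>card T < n\<close>, so the truncated difference \<open>n - card J\<close> strictly
      decreases.\<close>
    moreover have "card J \<le> n"
      using card_mono[OF _ sub] by simp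
    ultimately show "unit_vec J \<in> ?V"
      using J by (intro less.hyps) auto
  qed
  ultimately have "(\<Sum>J \<in> ?U. unit_vec J) - (\<Sum>J \<in> ?U - {T}. unit_vec J) \<in> ?V"
    by (rule entropy_vec.span_diff)
  moreover have "(\<Sum>J \<in> ?U. unit_vec J) = unit_vec T + (\<Sum>J \<in> ?U - {T}. unit_vec J)"
    using less.prems finite_index_sets by (intro sum.remove) auto
  ultimately show ?case
    by (simp only: add_diff_cancel_right')
qed

lemma entropy_space_eq_span: "entropy_space n = entropy_vec.span (unit_vec ` index_sets n)"
proof
  show "entropy_space n \<subseteq> entropy_vec.span (unit_vec ` index_sets n)"
  proof
    fix S assume S: "S \<in> entropy_space n"
    have "S = (\<Sum>J \<in> index_sets n. scale_vec (S J) (unit_vec J))"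
    proof
      fix I
      show "S I = (\<Sum>J \<in> index_sets n. scale_vec (S J) (unit_vec J)) I"
        using S by (simp add: sum_fun_apply scale_vec_def unit_vec_def finite_index_sets
            entropy_space_def if_distrib cong: if_cong)
    qed
    also have "\<dots> \<in> entropy_vec.span (unit_vec ` index_sets n)"
      by (intro entropy_vec.span_sum entropy_vec.span_scale entropy_vec.span_base) auto
    finally show "S \<in> entropy_vec.span (unit_vec ` index_sets n)" .
  qed
  show "entropy_vec.span (unit_vec ` index_sets n) \<subseteq> entropy_space n"
    by (rule entropy_vec.span_minimal)
      (auto simp: unit_vec_def entropy_space_def scale_vec_def entropy_vec.subspace_def)
qed

lemma inj_unit_vec: "inj unit_vec"
  by (rule injI) (metis unit_vec_def zero_neq_one)

text \<open>Evaluating a vanishing combination at \<open>J\<close> isolates the coefficient of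
  \<open>unit_vec J\<close>.\<close>

lemma independent_unit_vecs: "\<not> entropy_vec.dependent (unit_vec ` A)"
  unfolding entropy_vec.dependent_explicit
proof -
  show "\<not> (\<exists>t u. finite t \<and> t \<subseteq> unit_vec ` A \<and> (\<Sum>v\<in>t. scale_vec (u v) v) = 0
      \<and> (\<exists>v\<in>t. u v \<noteq> 0))"
  proof clarify
    fix t u v
    assume t: "finite t" "t \<subseteq> unit_vec ` A" "(\<Sum>v\<in>t. scale_vec (u v) v) = 0"
      and v: "v \<in> t" "u v \<noteq> 0"
    then obtain J where J: "v = unit_vec J"
      by auto
    have "x J = (if x = v then 1 else 0)" if "x \<in> t" for x
      using that t(2) J by (auto simp: unit_vec_def)
    then have "(\<Sum>x\<in>t. scale_vec (u x) x) J = (\<Sum>x\<in>t. u x * (if x = v then 1 else 0))"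
      by (auto simp: sum_fun_apply scale_vec_def intro!: sum.cong)
    also have "\<dots> = u v"
      using t(1) v(1) by (simp add: if_distrib cong: if_cong)
    finally show False
      using t(3) v(2) by simp
  qed
qed

theorem proposition1:
  fixes n :: nat
  assumes "1 \<le> n"
  shows "holographic_entropy_cone n \<subseteq> entropy_space n
    \<and> is_cone (holographic_entropy_cone n)
    \<and> entropy_vec.dim (entropy_vec.span (holographic_entropy_cone n)) = 2 ^ n - 1"
proof (intro conjI)
  show sub: "holographic_entropy_cone n \<subseteq> entropy_space n"
    by (auto simp: holographic_entropy_cone_def)
  show "is_cone (holographic_entropy_cone n)"
    by (rule is_cone_holographic_entropy_cone)
  \<comment> \<open>Each span contains the generators of the other; the unit vectors are then a
    basis to count.\<close>
  have "entropy_vec.span (holographic_entropy_cone n) = entropy_vec.span (unit_vec ` index_sets n)"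
    using sub unit_vec_in_span_cone
    by (intro entropy_vec.span_eq[THEN iffD2]) (auto simp: entropy_space_eq_span)
  then have "entropy_vec.dim (entropy_vec.span (holographic_entropy_cone n))
      = card (unit_vec ` index_sets n)"
    by (simp add: entropy_vec.dim_eq_card_independent independent_unit_vecs)
  also have "\<dots> = 2 ^ n - 1"
    by (simp add: card_image inj_on_subset[OF inj_unit_vec] card_index_sets)
  finally show "entropy_vec.dim (entropy_vec.span (holographic_entropy_cone n)) = 2 ^ n - 1" .
qed

end
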